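(* Let $l\ge 2$ and $d_1,\ldots,d_l\ge 2$ be integers. The action $(T,Q)\mapsto TQ:=\{Tu:u\in Q\}$ of $GL_{\otimes}(\otimes_{i=1}^{l}\mathbb{R}^{d_{i}})$ on $\mathcal{B}_{\otimes}(\otimes_{i=1}^{l}\mathbb{R}^{d_{i}})$ is proper (in the sense of Palais).
   Context: $\otimes_{i=1}^l\mathbb{R}^{d_i}$ is a Euclidean space with the scalar product $\langle\cdot,\cdot\rangle_H$ determined by $\langle x^1\otimes\cdots\otimes x^l,y^1\otimes\cdots\otimes y^l\rangle_H=\prod_{i=1}^l\langle x^i,y^i\rangle$. A $0$-symmetric convex body in a finite-dimensional Euclidean space $\mathbb{E}$ is a compact convex set $Q\subset\mathbb{E}$ with nonempty interior and $Q=-Q$. Its polar is $Q^\circ=\{y\in\mathbb{E}:\sup_{x\in Q}|\langle x,y\rangle|\le 1\}$. For $0$-symmetric convex bodies $Q_i\subset\mathbb{R}^{d_i}$: $Q_1\otimes_\pi\cdots\otimes_\pi Q_l:=\mathrm{conv}\{x^1\otimes\cdots\otimes x^l: x^i\in Q_i\}$ and $Q_1\otimes_\epsilon\cdots\otimes_\epsilon Q_l:=(Q_1^\circ\otimes_\pi\cdots\otimes_\pi Q_l^\circ)^\circ$. A $0$-symmetric convex body $Q\subset\otimes_{i=1}^l\mathbb{R}^{d_i}$ is a tensorial body if there exist $0$-symmetric convex bodies $Q_i\subset\mathbb{R}^{d_i}$ with $Q_1\otimes_\pi\cdots\otimes_\pi Q_l\subseteq Q\subseteq Q_1\otimes_\epsilon\cdots\otimes_\epsilon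 Q_l$. The set of tensorial bodies is $\mathcal{B}_\otimes(\otimes_{i=1}^l\mathbb{R}^{d_i})$, with the topology of the Hausdorff distance $\delta^H(P,Q)=\min\{\lambda\ge0: P\subseteq Q+\lambda B,\ Q\subseteq P+\lambda B\}$, where $B$ is the closed unit ball of $(\otimes_{i=1}^l\mathbb{R}^{d_i},\langle\cdot,\cdot\rangle_H)$. A decomposable vector is one of the form $x^1\otimes\cdots\otimes x^l$. $GL_\otimes(\otimes_{i=1}^l\mathbb{R}^{d_i})$ is the group of linear isomorphisms $T$ of $\otimes_{i=1}^l\mathbb{R}^{d_i}$ such that $T(x^1\otimes\cdots\otimes x^l)$ is decomposable for all $x^i\in\mathbb{R}^{d_i}$; it is a closed subgroup of $GL(\otimes_{i=1}^l\mathbb{R}^{d_i})$, with the subspace topology, and it maps tensorial bodies to tensorial bodies. Let $G$ be a locally compact group acting continuously on a Tychonoff space $X$. A subset $S\subseteq X$ is small if every $x\in X$ has a neighborhood $V$ such that $\{g\in G: gS\cap V\ne\emptyset\}$ has compact closure in $G$. The action is proper (in the sense of Palais) if every $x\in X$ has a small neighborhood. *)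

theory Defs
  imports "HOL-Analysis.Analysis"
begin

section \<open>Tensor products of coordinate spaces\<close>

text \<open>
  The factors are indexed by a finite type \<open>'i\<close>, so that \<open>l = CARD('i)\<close>. The numbers \<open>d\<^sub>i\<close> depend
  on \<open>i\<close>, so they cannot be dimensions of types; instead the \<open>i\<close>-th factor is the space of
  vectors with coordinates in an index set \<open>D i\<close> having \<open>d\<^sub>i\<close> elements, that is, a coordinate
  subspace of \<open>real ^ 'k\<close> for a large enough finite type \<open>'k\<close>.
\<close>

definition coord_space :: "'k::finite set \<Rightarrow> (real ^ 'k) set" where
  "coord_space A = {x. \<forall>j. j \<notin> A \<longrightarrow> x $ j = 0}"

text \<open>
  The tensor product is \<open>real ^ 'm\<close>, where the finite type \<open>'m\<close> enumerates the multi-indices: below,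
  \<open>idx\<close> is always a bijection from \<open>'m\<close> onto the product \<open>Pi UNIV D\<close> of the index sets.
\<close>

definition tensor :: "('m::finite \<Rightarrow> 'i::finite \<Rightarrow> 'k::finite) \<Rightarrow> ('i \<Rightarrow> real ^ 'k) \<Rightarrow> real ^ 'm" where
  "tensor idx x = (\<chi> m. \<Prod>i\<in>UNIV. x i $ idx m i)"

definition decomposable :: "('m::finite \<Rightarrow> 'i::finite \<Rightarrow> 'k::finite) \<Rightarrow> ('i \<Rightarrow> 'k set) \<Rightarrow> (real ^ 'm) set" where
  "decomposable idx D = {tensor idx x | x. \<forall>i. x i \<in> coord_space (D i)}"

text \<open>
  The next two lemmas show that the standard inner product of \<open>real ^ 'm\<close> is the scalar product
  determined by the inner products of the factors.
\<close>

lemma inner_tensor: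
  fixes idx :: "'m::finite \<Rightarrow> 'i::finite \<Rightarrow> 'k::finite"
  assumes idx: "bij_betw idx UNIV (Pi UNIV D)"
    and x: "\<And>i. x i \<in> coord_space (D i)"
  shows "tensor idx x \<bullet> tensor idx y = (\<Prod>i\<in>UNIV. x i \<bullet> y i)"
proof -
  have "(\<Prod>i\<in>UNIV. x i \<bullet> y i) = (\<Prod>i\<in>UNIV. \<Sum>j\<in>D i. x i $ j * y i $ j)"
  proof (rule prod.cong[OF refl])
    fix i
    show "x i \<bullet> y i = (\<Sum>j\<in>D i. x i $ j * y i $ j)"
      unfolding inner_vec_def inner_real_def using x[of i]
      by (intro sum.mono_neutral_right) (auto simp: coord_space_def)
  qed
  also have "\<dots> = (\<Sum>g\<in>Pi UNIV D. \<Prod>i\<in>UNIV. x i $ g i * y i $ g i)"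
    using prod_sum_PiE[of UNIV D "\<lambda>i j. x i $ j * y i $ j"] by (simp add: PiE_UNIV_domain)
  also have "\<dots> = (\<Sum>m\<in>UNIV. \<Prod>i\<in>UNIV. x i $ idx m i * y i $ idx m i)"
    by (rule sum.reindex_bij_betw[OF idx, symmetric])
  also have "\<dots> = tensor idx x \<bullet> tensor idx y"
    by (simp add: tensor_def inner_vec_def prod.distrib)
  finally show ?thesis by simp
qed

lemma span_decomposable:
  fixes idx :: "'m::finite \<Rightarrow> 'i::finite \<Rightarrow> 'k::finite"
  assumes idx: "bij_betw idx UNIV (Pi UNIV D)"
  shows "span (decomposable idx D) = UNIV"
proof -
  have "Basis \<subseteq> decomposable idx D"
  proof
    fix b :: "real ^ 'm" assume "b \<in> Basis"
    then obtain m where b: "b = axis m 1" by (auto simp: Basis_vec_def)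
    have "b = tensor idx (\<lambda>i. axis (idx m i) 1)"
    proof (subst vec_eq_iff, intro allI)
      fix m'
      have "m' = m \<longleftrightarrow> (\<forall>i. idx m' i = idx m i)"
        using bij_betw_imp_inj_on[OF idx] by (auto dest: injD)
      then show "b $ m' = tensor idx (\<lambda>i. axis (idx m i) 1) $ m'"
        by (auto simp: b tensor_def axis_def)
    qed
    moreover have "\<forall>i. axis (idx m i) 1 \<in> coord_space (D i)"
      using bij_betwE[OF idx] by (auto simp: coord_space_def axis_def Pi_def)
    ultimately show "b \<in> decomposable idx D" unfolding decomposable_def by blast
  qed
  then show ?thesis by (metis span_Basis span_mono top.extremum_uniqueI)
qed

section \<open>Tensorial bodies\<close>

text \<open>The Euclidean space is a linear subspace \<open>E\<close> of its type; the interior is taken relative to \<open>E\<close>.\<close>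

definition sym_convex_body :: "'a::euclidean_space set \<Rightarrow> 'a set \<Rightarrow> bool" where
  "sym_convex_body E Q \<longleftrightarrow>
     Q \<subseteq> E \<and> compact Q \<and> convex Q \<and> (top_of_set E) interior_of Q \<noteq> {} \<and> Q = uminus ` Q"

definition polar :: "'a::euclidean_space set \<Rightarrow> 'a set \<Rightarrow> 'a set" where
  "polar E Q = {y \<in> E. \<forall>x\<in>Q. \<bar>x \<bullet> y\<bar> \<le> 1}"

definition proj_tensor ::
  "('m::finite \<Rightarrow> 'i::finite \<Rightarrow> 'k::finite) \<Rightarrow> ('i \<Rightarrow> (real ^ 'k) set) \<Rightarrow> (real ^ 'm) set" where
  "proj_tensor idx R = convex hull {tensor idx x | x. \<forall>i. x i \<in> R i}"

definition inj_tensor ::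
  "('m::finite \<Rightarrow> 'i::finite \<Rightarrow> 'k::finite) \<Rightarrow> ('i \<Rightarrow> 'k set) \<Rightarrow> ('i \<Rightarrow> (real ^ 'k) set)
     \<Rightarrow> (real ^ 'm) set" where
  "inj_tensor idx D R = polar UNIV (proj_tensor idx (\<lambda>i. polar (coord_space (D i)) (R i)))"

definition tensorial_bodies ::
  "('m::finite \<Rightarrow> 'i::finite \<Rightarrow> 'k::finite) \<Rightarrow> ('i \<Rightarrow> 'k set) \<Rightarrow> (real ^ 'm) set set" where
  "tensorial_bodies idx D =
     {Q. sym_convex_body UNIV Q \<and>
         (\<exists>R. (\<forall>i. sym_convex_body (coord_space (D i)) (R i)) \<and>
              proj_tensor idx R \<subseteq> Q \<and> Q \<subseteq> inj_tensor idx D R)}"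

definition hausdorff_within :: "'a::euclidean_space set \<Rightarrow> 'a set \<Rightarrow> real \<Rightarrow> bool" where
  "hausdorff_within P Q c \<longleftrightarrow>
     0 \<le> c \<and> P \<subseteq> {q + c *\<^sub>R b | q b. q \<in> Q \<and> b \<in> cball 0 1} \<and>
             Q \<subseteq> {p + c *\<^sub>R b | p b. p \<in> P \<and> b \<in> cball 0 1}"

text \<open>
  The value for sets at infinite distance is a convention; it does not occur for nonempty compact
  sets, for which the infimum is attained (\<open>hausdorff_attained\<close> below).
\<close>

definition hausdorff :: "'a::euclidean_space set \<Rightarrow> 'a set \<Rightarrow> real" where
  "hausdorff P Q =
     (if \<exists>c. hausdorff_within P Q c then Inf {c. hausdorff_within P Q c} else 0)"

definition tensorial_topology ::
  "('m::finite \<Rightarrow> 'i::finite \<Rightarrow> 'k::finite) \<Rightarrow> ('i \<Rightarrow> 'k set) \<Rightarrow> (real ^ 'm) set topology" where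
  "tensorial_topology idx D = Metric_space.mtopology (tensorial_bodies idx D) hausdorff"

text \<open>
  \<open>Metric_space.mtopology\<close> is meaningful only for a metric; the lemmas up to
  \<open>Metric_space_hausdorff\<close> verify this.
\<close>

lemma subset_enlargement_iff:
  fixes P Q :: "'a::euclidean_space set"
  assumes "closed Q" "Q \<noteq> {}" "0 \<le> c"
  shows "P \<subseteq> {q + c *\<^sub>R b | q b. q \<in> Q \<and> b \<in> cball 0 1} \<longleftrightarrow> (\<forall>p\<in>P. infdist p Q \<le> c)"
proof -
  have "(\<exists>q b. p = q + c *\<^sub>R b \<and> q \<in> Q \<and> b \<in> cball 0 1) \<longleftrightarrow> infdist p Q \<le> c" for p
  proof
    assume "\<exists>q b. p = q + c *\<^sub>R b \<and> q \<in> Q \<and> b \<in> cball 0 1"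
    then obtain q b where *: "p = q + c *\<^sub>R b" "q \<in> Q" "norm b \<le> 1" by auto
    have "infdist p Q \<le> dist p q" using *(2) by (rule infdist_le)
    also have "\<dots> \<le> c" using * assms(3) by (simp add: dist_norm mult_left_le)
    finally show "infdist p Q \<le> c" .
  next
    assume le: "infdist p Q \<le> c"
    obtain q where q: "q \<in> Q" "infdist p Q = dist p q"
      using infdist_attains_inf[OF assms(1,2)] by blast
    then have d: "norm (p - q) \<le> c" using le by (simp add: dist_norm)
    have "p = q + c *\<^sub>R ((1 / c) *\<^sub>R (p - q))" using d by (cases "c = 0") auto
    moreover have "norm ((1 / c) *\<^sub>R (p - q)) \<le> 1"
      using d assms(3) by (cases "c = 0") (auto simp: divide_le_eq)
    ultimately show "\<exists>q b. p = q + c *\<^sub>R b \<and> q \<in> Q \<and> b \<in> cball 0 1"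
      using q(1) by (metis dist_0_norm mem_cball)
  qed
  then show ?thesis by auto
qed

lemma hausdorff_within_iff:
  fixes P Q :: "'a::euclidean_space set"
  assumes P: "compact P" "P \<noteq> {}" and Q: "compact Q" "Q \<noteq> {}"
  shows "hausdorff_within P Q c \<longleftrightarrow> (\<forall>p\<in>P. infdist p Q \<le> c) \<and> (\<forall>q\<in>Q. infdist q P \<le> c)"
proof -
  have "0 \<le> c" if "\<forall>p\<in>P. infdist p Q \<le> c"
    using that P(2) infdist_nonneg by (meson ex_in_conv order_trans)
  then show ?thesis
    unfolding hausdorff_within_def
    using subset_enlargement_iff[OF compact_imp_closed[OF Q(1)] Q(2), of c P]
      subset_enlargement_iff[OF compact_imp_closed[OF P(1)] P(2), of c Q]
    by blast
qed

lemma hausdorff_within_ex: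
  fixes P Q :: "'a::euclidean_space set"
  assumes P: "compact P" "P \<noteq> {}" and Q: "compact Q" "Q \<noteq> {}"
  shows "\<exists>c. hausdorff_within P Q c"
proof -
  have b: "bounded (P \<union> Q)" using P(1) Q(1) by (simp add: compact_imp_bounded)
  obtain p q where pq: "p \<in> P" "q \<in> Q" using P(2) Q(2) by blast
  have d: "dist x y \<le> diameter (P \<union> Q)" if "x \<in> P \<union> Q" "y \<in> P \<union> Q" for x y
    using diameter_bounded_bound[OF b that] .
  have "infdist x Q \<le> diameter (P \<union> Q)" if "x \<in> P" for x
    by (rule infdist_le2[OF pq(2)]) (use d that pq in auto)
  moreover have "infdist x P \<le> diameter (P \<union> Q)" if "x \<in> Q" for x
    by (rule infdist_le2[OF pq(1)]) (use d that pq in auto)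
  ultimately show ?thesis unfolding hausdorff_within_iff[OF assms] by blast
qed

lemma hausdorff_nonneg: "0 \<le> hausdorff P Q"
  unfolding hausdorff_def
  by (auto simp: hausdorff_within_def intro!: cInf_greatest)

lemma hausdorff_commute: "hausdorff P Q = hausdorff Q P"
proof -
  have "hausdorff_within P Q = hausdorff_within Q P"
    by (auto simp: hausdorff_within_def fun_eq_iff)
  then show ?thesis by (simp add: hausdorff_def)
qed

lemma hausdorff_attained:
  fixes P Q :: "'a::euclidean_space set"
  assumes "compact P" "P \<noteq> {}" "compact Q" "Q \<noteq> {}"
  shows "hausdorff_within P Q (hausdorff P Q)"
proof -
  have ne: "{c. hausdorff_within P Q c} \<noteq> {}" using hausdorff_within_ex[OF assms] by simp
  have h: "hausdorff P Q = Inf {c. hausdorff_within P Q c}"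
    using hausdorff_within_ex[OF assms] by (simp add: hausdorff_def)
  have "infdist p Q \<le> hausdorff P Q" if "p \<in> P" for p
    unfolding h by (rule cInf_greatest[OF ne]) (use that in \<open>simp add: hausdorff_within_iff[OF assms]\<close>)
  moreover have "infdist q P \<le> hausdorff P Q" if "q \<in> Q" for q
    unfolding h by (rule cInf_greatest[OF ne]) (use that in \<open>simp add: hausdorff_within_iff[OF assms]\<close>)
  ultimately show ?thesis by (simp add: hausdorff_within_iff[OF assms])
qed

lemma hausdorff_le:
  assumes "hausdorff_within P Q c"
  shows "hausdorff P Q \<le> c"
proof -
  have "bdd_below {c. hausdorff_within P Q c}"
    by (rule bdd_belowI[of _ 0]) (simp add: hausdorff_within_def)
  then have "Inf {c. hausdorff_within P Q c} \<le> c" using assms by (intro cInf_lower) auto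
  then show ?thesis using assms by (auto simp: hausdorff_def)
qed

lemma Metric_space_hausdorff:
  fixes idx :: "'m::finite \<Rightarrow> 'i::finite \<Rightarrow> 'k::finite"
  shows "Metric_space (tensorial_bodies idx D) hausdorff"
proof
  have body: "compact Q" "Q \<noteq> {}" if "Q \<in> tensorial_bodies idx D" for Q
    using that by (auto simp: tensorial_bodies_def sym_convex_body_def)
  show "0 \<le> hausdorff P Q" for P Q :: "(real ^ 'm) set" by (rule hausdorff_nonneg)
  show "hausdorff P Q = hausdorff Q P" for P Q :: "(real ^ 'm) set" by (rule hausdorff_commute)
  fix P Q R
  assume P: "P \<in> tensorial_bodies idx D" and Q: "Q \<in> tensorial_bodies idx D"
  note PQ = body[OF P] body[OF Q]
  show "hausdorff P Q = 0 \<longleftrightarrow> P = Q"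
  proof
    assume "hausdorff P Q = 0"
    with hausdorff_attained[OF PQ] show "P = Q" by (auto simp: hausdorff_within_def)
  next
    assume "P = Q"
    then have "hausdorff_within P Q 0" by (simp add: hausdorff_within_iff PQ)
    then show "hausdorff P Q = 0" using hausdorff_le hausdorff_nonneg by (metis antisym)
  qed
  assume R: "R \<in> tensorial_bodies idx D"
  have tri: "infdist x C \<le> a + b"
    if ab: "infdist x B \<le> a" "\<forall>y\<in>B. infdist y C \<le> b"
      and B: "compact B" "B \<noteq> {}" for x a b and B C :: "(real ^ 'm) set"
  proof -
    obtain y where y: "y \<in> B" "infdist x B = dist x y"
      using infdist_attains_inf[OF compact_imp_closed[OF B(1)] B(2)] by blast
    then show ?thesis using infdist_triangle[of x C y] ab by fastforce
  qed
  have 1: "hausdorff_within P Q (hausdorff P Q)" "hausdorff_within Q R (hausdorff Q R)"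
    using hausdorff_attained body P Q R by blast+
  have "hausdorff_within P R (hausdorff P Q + hausdorff Q R)"
    using 1 unfolding hausdorff_within_iff[OF body[OF P] body[OF Q]]
      hausdorff_within_iff[OF body[OF Q] body[OF R]] hausdorff_within_iff[OF body[OF P] body[OF R]]
    using tri[OF _ _ body[OF Q]] by (metis add.commute)
  then show "hausdorff P R \<le> hausdorff P Q + hausdorff Q R" by (rule hausdorff_le)
qed

section \<open>The group of decomposability-preserving isomorphisms\<close>

text \<open>Its topology is the subspace topology inherited from the normed space of linear maps.\<close>

definition gl_tensor ::
  "('m::finite \<Rightarrow> 'i::finite \<Rightarrow> 'k::finite) \<Rightarrow> ('i \<Rightarrow> 'k set) \<Rightarrow> ((real ^ 'm) \<Rightarrow>\<^sub>L (real ^ 'm)) set" where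
  "gl_tensor idx D =
     {T. bij (blinfun_apply T) \<and>
         (\<forall>x. (\<forall>i. x i \<in> coord_space (D i)) \<longrightarrow> blinfun_apply T (tensor idx x) \<in> decomposable idx D)}"

section \<open>Proper actions in the sense of Palais\<close>

text \<open>
  \<open>G\<close> and \<open>X\<close> are the topologies of the group and of the space, \<open>act\<close> is the action. The
  predicates are meant for continuous actions of locally compact groups on Tychonoff spaces.
\<close>

definition is_nbhd :: "'x topology \<Rightarrow> 'x \<Rightarrow> 'x set \<Rightarrow> bool" where
  "is_nbhd X x V \<longleftrightarrow> V \<subseteq> topspace X \<and> x \<in> X interior_of V"

definition small_set :: "'g topology \<Rightarrow> 'x topology \<Rightarrow> ('g \<Rightarrow> 'x \<Rightarrow> 'x) \<Rightarrow> 'x set \<Rightarrow> bool" where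
  "small_set G X act S \<longleftrightarrow>
     S \<subseteq> topspace X \<and>
     (\<forall>x\<in>topspace X. \<exists>V. is_nbhd X x V \<and>
        compactin G (G closure_of {g \<in> topspace G. act g ` S \<inter> V \<noteq> {}}))"

definition palais_proper :: "'g topology \<Rightarrow> 'x topology \<Rightarrow> ('g \<Rightarrow> 'x \<Rightarrow> 'x) \<Rightarrow> bool" where
  "palais_proper G X act \<longleftrightarrow> (\<forall>x\<in>topspace X. \<exists>S. is_nbhd X x S \<and> small_set G X act S)"

end

theory Submission
  imports Defs
begin

text \<open>
  Near a symmetric convex body all bodies contain a fixed ball and are contained in a fixed ball.
  Hence, if \<open>T\<close> maps a body near \<open>Q\<close> to a body near \<open>Q'\<close>, both \<open>T\<close> and its inverse are bounded by
  constants that depend only on \<open>Q\<close> and \<open>Q'\<close>. The maps in the group satisfying such bounds form a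
  compact set, because the set of decomposable vectors is closed.
\<close>

section \<open>Balls inside and around bodies close to a given body\<close>

text \<open>Take a ball in \<open>Q\<close> around an interior point \<open>a\<close>. Each short
  vector \<open>x\<close> is the midpoint of \<open>a + x\<close> and of \<open>x - a\<close>, the
  reflection of \<open>a - x\<close>, so symmetry and convexity move the ball to the origin.\<close>

lemma sym_convex_body_cball:
  fixes Q :: "'a::euclidean_space set"
  assumes "sym_convex_body UNIV Q"
  obtains r where "r > 0" "cball 0 r \<subseteq> Q"
proof -
  have Q: "convex Q" "interior Q \<noteq> {}" "Q = uminus ` Q"
    using assms by (auto simp: sym_convex_body_def interior_of_openin interior_def)
  then obtain a e where e: "e > 0" "cball a e \<subseteq> Q"
    by (metis all_not_in_conv mem_interior_cball)
  have "cball 0 e \<subseteq> Q"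
  proof
    fix x :: 'a assume x: "x \<in> cball 0 e"
    have "a + x \<in> Q" "a - x \<in> Q" using e x by (auto simp: dist_norm subset_iff)
    then have "- (a - x) \<in> Q" using Q(3) by blast
    then have "(1/2) *\<^sub>R (a + x) + (1/2) *\<^sub>R (- (a - x)) \<in> Q"
      using \<open>a + x \<in> Q\<close> Q(1) by (intro convexD) auto
    also have "(1/2) *\<^sub>R (a + x) + (1/2) *\<^sub>R (- (a - x)) = x"
      by (simp add: algebra_simps flip: scaleR_left_distrib)
    finally show "x \<in> Q" .
  qed
  with e(1) show thesis by (rule that)
qed

text \<open>A hyperplane separating \<open>P\<close> from a point \<open>y\<close> of
  \<open>cball 0 s\<close> would keep \<open>P\<close> too far from \<open>Q\<close>: the point of
  \<open>cball 0 r\<close> lying deepest on the side of \<open>y\<close> has distance greater than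
  \<open>c\<close> from the half-space that contains \<open>P\<close>.\<close>

lemma cball_subset_of_hausdorff_within:
  fixes P Q :: "'a::euclidean_space set"
  assumes P: "closed P" "convex P" and h: "hausdorff_within Q P c"
    and Q: "cball 0 r \<subseteq> Q" and s: "s + c < r"
  shows "cball 0 s \<subseteq> P"
proof
  fix y :: 'a assume y: "y \<in> cball 0 s"
  have c: "0 \<le> c" and sub: "Q \<subseteq> {p + c *\<^sub>R b | p b. p \<in> P \<and> b \<in> cball 0 1}"
    using h by (auto simp: hausdorff_within_def)
  have "0 \<le> s" using y by (simp add: order_trans[OF norm_ge_zero])
  show "y \<in> P"
  proof (rule ccontr)
    assume "y \<notin> P"
    then obtain a b where ab: "a \<bullet> y < b" "\<forall>x\<in>P. b < a \<bullet> x"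
      using separating_hyperplane_closed_point[OF P(2,1)] by blast
    have "0 \<in> Q" using Q \<open>0 \<le> s\<close> c s by auto
    \<comment> \<open>A point of \<open>P\<close> is needed to exclude \<open>a = 0\<close>, for
      which the separation would give \<open>0 < b\<close> and \<open>b < 0\<close>.\<close>
    then have "P \<noteq> {}" using sub by blast
    then have "a \<noteq> 0" using ab by fastforce
    \<comment> \<open>This is the minimizer of the functional given by \<open>a\<close> on
      \<open>cball 0 r\<close>. A point of \<open>P\<close> within \<open>c\<close> of it has value
      at most \<open>(c - r) * norm a\<close>, which is below every value on
      \<open>cball 0 s\<close>.\<close>
    have "norm ((- r / norm a) *\<^sub>R a) \<le> r" using \<open>a \<noteq> 0\<close> \<open>0 \<le> s\<close> c s by simp
    then have "(- r / norm a) *\<^sub>R a \<in> Q" using Q by (simp add: subset_iff)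
    then obtain p u where pu: "(- r / norm a) *\<^sub>R a = p + c *\<^sub>R u" "p \<in> P" "norm u \<le> 1"
      using sub by auto
    have "a \<bullet> (p + c *\<^sub>R u) = - r * norm a"
      unfolding pu(1)[symmetric] using \<open>a \<noteq> 0\<close> by (simp add: dot_square_norm power2_eq_square)
    moreover have "- (a \<bullet> (c *\<^sub>R u)) \<le> c * norm a"
    proof -
      have "- (a \<bullet> u) \<le> norm a * norm u" using norm_cauchy_schwarz[of "-a" u] by simp
      also have "\<dots> \<le> norm a" using pu(3) by (simp add: mult_left_le)
      finally show ?thesis using mult_left_mono[OF _ c] by fastforce
    qed
    ultimately have "a \<bullet> p \<le> (c - r) * norm a" by (simp add: inner_add_right algebra_simps)
    also have "\<dots> < - s * norm a" using \<open>a \<noteq> 0\<close> s by (intro mult_strict_right_mono) auto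
    also have "\<dots> \<le> a \<bullet> y"
    proof -
      have "- (a \<bullet> y) \<le> norm a * norm y" using norm_cauchy_schwarz[of "-a" y] by simp
      also have "\<dots> \<le> norm a * s" using y by (simp add: mult_left_mono)
      finally show ?thesis by (simp add: mult.commute)
    qed
    finally show False using ab pu(2) by fastforce
  qed
qed

lemma subset_cball_of_hausdorff_within:
  fixes P Q :: "'a::euclidean_space set"
  assumes h: "hausdorff_within Q P c" and Q: "Q \<subseteq> cball 0 r"
  shows "P \<subseteq> cball 0 (r + c)"
proof
  fix p assume "p \<in> P"
  then obtain q b where q: "p = q + c *\<^sub>R b" "q \<in> Q" "norm b \<le> 1" and c: "0 \<le> c"
    using h by (auto simp: hausdorff_within_def)
  have "norm p \<le> norm q + c * norm b" using q(1) c norm_triangle_ineq[of q "c *\<^sub>R b"] by simp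
  also have "\<dots> \<le> r + c" using q Q c by (intro add_mono mult_left_le) auto
  finally show "p \<in> cball 0 (r + c)" by simp
qed

lemma uniform_balls_near_body:
  fixes idx :: "'m::finite \<Rightarrow> 'i::finite \<Rightarrow> 'k::finite"
  assumes Q: "Q \<in> tensorial_bodies idx D"
  obtains S r t where "is_nbhd (tensorial_topology idx D) Q S" "r > 0" "t > 0"
    "\<And>P. P \<in> S \<Longrightarrow> cball 0 r \<subseteq> P \<and> P \<subseteq> cball 0 t"
proof -
  interpret Metric_space "tensorial_bodies idx D" hausdorff by (rule Metric_space_hausdorff)
  have body: "compact P" "P \<noteq> {}" "convex P" if "P \<in> tensorial_bodies idx D" for P
    using that by (auto simp: tensorial_bodies_def sym_convex_body_def)
  obtain r where r: "r > 0" "cball 0 r \<subseteq> Q"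
    using Q sym_convex_body_cball by (auto simp: tensorial_bodies_def)
  obtain t where t: "t > 0" "Q \<subseteq> cball 0 t"
    using bounded_subset_ballD[OF compact_imp_bounded[OF body(1)[OF Q]], of 0]
    by (meson ball_subset_cball order_trans)
  \<comment> \<open>With radius \<open>r / 2\<close>, half of the inner radius of \<open>Q\<close>
    survives: \<open>r / 2 + hausdorff Q P < r\<close> for every \<open>P\<close> in this
    ball.\<close>
  have "openin mtopology (mball Q (r / 2))" by simp
  moreover have "Q \<in> mball Q (r / 2)" using Q r by simp
  ultimately have "is_nbhd (tensorial_topology idx D) Q (mball Q (r / 2))"
    unfolding is_nbhd_def tensorial_topology_def
    by (metis interior_of_openin openin_subset)
  moreover have "cball 0 (r / 2) \<subseteq> P \<and> P \<subseteq> cball 0 (t + r / 2)" if "P \<in> mball Q (r / 2)" for P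
  proof -
    have P: "P \<in> tensorial_bodies idx D" and d: "hausdorff Q P < r / 2" using that by auto
    have h: "hausdorff_within Q P (hausdorff Q P)"
      using hausdorff_attained body P Q by blast
    have "cball 0 (r / 2) \<subseteq> P"
      using cball_subset_of_hausdorff_within[OF _ _ h r(2)] body[OF P] d
      by (simp add: compact_imp_closed)
    moreover have "P \<subseteq> cball 0 (t + r / 2)"
      using subset_cball_of_hausdorff_within[OF h t(2)] d by fastforce
    ultimately show ?thesis ..
  qed
  moreover have "r / 2 > 0" "t + r / 2 > 0" using r t by simp_all
  ultimately show thesis using that by blast
qed

section \<open>Closedness of the set of decomposable vectors\<close>

lemma norm_tensor:
  fixes idx :: "'m::finite \<Rightarrow> 'i::finite \<Rightarrow> 'k::finite"
  assumes "bij_betw idx UNIV (Pi UNIV D)" and "\<And>i. x i \<in> coord_space (D i)"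
  shows "norm (tensor idx x) = (\<Prod>i\<in>UNIV. norm (x i))"
proof -
  have "sqrt (\<Prod>i\<in>A. x i \<bullet> x i) = (\<Prod>i\<in>A. norm (x i))" for A
    by (induction A rule: infinite_finite_induct) (auto simp: real_sqrt_mult norm_eq_sqrt_inner)
  then show ?thesis by (simp add: norm_eq_sqrt_inner[of "tensor idx x"] inner_tensor[OF assms])
qed

lemma tensor_scaleR:
  fixes idx :: "'m::finite \<Rightarrow> 'i::finite \<Rightarrow> 'k::finite"
  shows "tensor idx (\<lambda>i. a i *\<^sub>R x i) = (\<Prod>i\<in>UNIV. a i) *\<^sub>R tensor idx x"
  by (simp add: tensor_def vec_eq_iff prod.distrib)

lemma scaleR_decomposable:
  fixes idx :: "'m::finite \<Rightarrow> 'i::finite \<Rightarrow> 'k::finite"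
  assumes "v \<in> decomposable idx D"
  shows "c *\<^sub>R v \<in> decomposable idx D"
proof -
  obtain x where x: "v = tensor idx x" "\<forall>i. x i \<in> coord_space (D i)"
    using assms by (auto simp: decomposable_def)
  \<comment> \<open>Any single factor can absorb the scalar, so an arbitrary index will do.\<close>
  define k :: 'i where "k = undefined"
  have "(\<Prod>i\<in>UNIV. if i = k then c else 1) = c" by (simp add: prod.delta)
  then have "c *\<^sub>R v = tensor idx (\<lambda>i. (if i = k then c else 1) *\<^sub>R x i)"
    by (simp only: tensor_scaleR x(1))
  moreover have "\<forall>i. (if i = k then c else 1) *\<^sub>R x i \<in> coord_space (D i)"
    using x(2) by (auto simp: coord_space_def)
  ultimately show ?thesis unfolding decomposable_def by blast
qed

lemma closed_decomposable:
  fixes idx :: "'m::finite \<Rightarrow> 'i::finite \<Rightarrow> 'k::finite"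
  assumes idx: "bij_betw idx UNIV (Pi UNIV D)"
  shows "closed (decomposable idx D)"
proof -
  \<comment> \<open>Factors of a bounded tensor may be unbounded, since scalars can be shifted
    between them. Hence the factors are kept in unit balls and one scalar carries the size.\<close>
  define U :: "((real ^ 'k) ^ 'i) set"
    where "U = {u. \<forall>i. u $ i \<in> coord_space (D i) \<and> norm (u $ i) \<le> 1}"
  define f :: "real \<times> ((real ^ 'k) ^ 'i) \<Rightarrow> real ^ 'm"
    where "f = (\<lambda>(c, u). c *\<^sub>R tensor idx (\<lambda>i. u $ i))"
  have "closed U"
    unfolding U_def coord_space_def mem_Collect_eq
    by (intro closed_Collect_all closed_Collect_conj closed_Collect_imp closed_Collect_eq
        closed_Collect_le continuous_intros) simp_all
  moreover have "bounded U"
  proof (rule boundedI)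
    fix u assume "u \<in> U"
    then have "(\<Sum>i\<in>UNIV. norm (u $ i)) \<le> (\<Sum>i\<in>(UNIV :: 'i set). 1)"
      by (intro sum_mono) (auto simp: U_def)
    then show "norm u \<le> real CARD('i)"
      using L2_set_le_sum[of UNIV "\<lambda>i. norm (u $ i)"] by (simp add: norm_vec_def)
  qed
  ultimately have U: "compact U" by (simp add: compact_eq_bounded_closed)
  have f: "continuous_on A f" for A
    unfolding f_def tensor_def case_prod_beta by (intro continuous_intros)
  have closed: "closed (f ` (cball 0 c \<times> U))" for c
    by (intro compact_imp_closed compact_continuous_image f compact_Times compact_cball U)
  have sub: "f ` (A \<times> U) \<subseteq> decomposable idx D" for A
  proof -
    have "tensor idx (\<lambda>i. u $ i) \<in> decomposable idx D" if "u \<in> U" for u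
      using that unfolding decomposable_def U_def by blast
    then show ?thesis by (auto simp: f_def intro: scaleR_decomposable)
  qed
  have sup: "v \<in> f ` (cball 0 c \<times> U)" if v: "v \<in> decomposable idx D" "norm v \<le> c" for v c
  proof -
    obtain x where x: "v = tensor idx x" "\<And>i. x i \<in> coord_space (D i)"
      using v by (auto simp: decomposable_def)
    \<comment> \<open>Since \<open>inverse 0 = 0\<close>, a zero factor stays zero. It still belongs
      to \<open>U\<close>, which asks for norm at most 1 and not equal to 1.\<close>
    define u :: "(real ^ 'k) ^ 'i" where "u = (\<chi> i. inverse (norm (x i)) *\<^sub>R x i)"
    have "norm (x i) *\<^sub>R u $ i = x i" for i by (cases "x i = 0") (simp_all add: u_def)
    then have "v = (\<Prod>i\<in>UNIV. norm (x i)) *\<^sub>R tensor idx (\<lambda>i. u $ i)"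
      using tensor_scaleR[of idx "\<lambda>i. norm (x i)" "\<lambda>i. u $ i"] x(1) by simp
    moreover have "norm v = (\<Prod>i\<in>UNIV. norm (x i))"
      unfolding x(1) by (rule norm_tensor[OF idx x(2)])
    ultimately have "v = f (norm v, u)" by (simp add: f_def)
    have "inverse (norm (x i)) * norm (x i) \<le> 1" for i by (cases "x i = 0") simp_all
    then have "u \<in> U"
      using x(2) by (auto simp: U_def u_def coord_space_def)
    with \<open>v = f _\<close> show ?thesis using v(2) by (intro image_eqI[of _ _ "(norm v, u)"]) auto
  qed
  show ?thesis
    unfolding closed_sequential_limits
  proof (intro allI impI)
    fix s v assume s: "(\<forall>n. s n \<in> decomposable idx D) \<and> s \<longlonglongrightarrow> v"
    then have "Bseq s" using convergent_imp_Bseq convergentI by blast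
    then obtain c where "\<And>n. norm (s n) \<le> c" unfolding Bseq_def by blast
    then have "s n \<in> f ` (cball 0 c \<times> U)" for n using s sup by blast
    then have "v \<in> f ` (cball 0 c \<times> U)" using s closed closed_sequentially by blast
    then show "v \<in> decomposable idx D" using sub by blast
  qed
qed

section \<open>Compact sets of maps in the group, and properness\<close>

text \<open>Bijectivity is not a closed condition, but the lower bound is one and forces
  injectivity, hence bijectivity in finite dimension. Preservation of decomposability is closed
  because evaluation at a vector is continuous in \<open>T\<close>. What remains is a closed subset
  of a compact ball of linear maps.\<close>

lemma compact_gl_tensor_bounded:
  fixes idx :: "'m::finite \<Rightarrow> 'i::finite \<Rightarrow> 'k::finite"
  assumes idx: "bij_betw idx UNIV (Pi UNIV D)" and b: "b > 0"
  shows "compact {T \<in> gl_tensor idx D. norm T \<le> a \<and> (\<forall>x. b * norm x \<le> norm (blinfun_apply T x))}"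
    (is "compact ?K")
proof -
  have bij: "bij (blinfun_apply T)"
    if "\<forall>x. b * norm x \<le> norm (blinfun_apply T x)" for T :: "(real ^ 'm) \<Rightarrow>\<^sub>L (real ^ 'm)"
  proof -
    have lin: "linear (blinfun_apply T)" by (simp add: blinfun.bounded_linear_right bounded_linear.linear)
    have "x = 0" if "blinfun_apply T x = 0" for x
    proof -
      have "b * norm x \<le> 0" using \<open>\<forall>x. _\<close> that by (metis norm_zero)
      then show ?thesis using b by (simp add: mult_le_0_iff)
    qed
    then have "inj (blinfun_apply T)" using lin linear_injective_0 by blast
    then show ?thesis using lin linear_injective_imp_surjective by (metis bijI)
  qed
  have "?K = {T. \<forall>x. (\<forall>i. x i \<in> coord_space (D i)) \<longrightarrow>
                blinfun_apply T (tensor idx x) \<in> decomposable idx D} \<inter>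
             {T. \<forall>x. b * norm x \<le> norm (blinfun_apply T x)} \<inter> cball 0 a"
    using bij by (auto simp: gl_tensor_def)
  moreover have "closed {T :: (real ^ 'm) \<Rightarrow>\<^sub>L (real ^ 'm). blinfun_apply T v \<in> decomposable idx D}" for v
    by (rule closed_vimage[OF closed_decomposable[OF idx], unfolded vimage_def])
      (intro continuous_intros)
  then have "closed {T. \<forall>x. (\<forall>i. x i \<in> coord_space (D i)) \<longrightarrow>
                blinfun_apply T (tensor idx x) \<in> decomposable idx D}"
    by (intro closed_Collect_all closed_Collect_imp) auto
  moreover have "closed {T :: (real ^ 'm) \<Rightarrow>\<^sub>L (real ^ 'm). \<forall>x. b * norm x \<le> norm (blinfun_apply T x)}"
    by (intro closed_Collect_all closed_Collect_le continuous_intros)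
  ultimately show ?thesis by (simp only: closed_Int closed_Int_compact compact_cball)
qed

text \<open>Scaling \<open>x\<close> to norm \<open>r\<close> puts it in \<open>P\<close>, so its
  image has norm at most \<open>t'\<close>. The same argument for the inverse of \<open>T\<close>,
  with the roles of \<open>P\<close> and its image exchanged, gives the lower bound.\<close>

lemma blinfun_bounds_of_image:
  fixes T :: "'a::euclidean_space \<Rightarrow>\<^sub>L 'a"
  assumes T: "bij (blinfun_apply T)" and "r > 0" "r' > 0" "t > 0" "t' > 0"
    and P: "cball 0 r \<subseteq> P" "P \<subseteq> cball 0 t"
    and TP: "cball 0 r' \<subseteq> blinfun_apply T ` P" "blinfun_apply T ` P \<subseteq> cball 0 t'"
  shows "norm T \<le> t' / r" and "r' / t * norm x \<le> norm (blinfun_apply T x)"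
proof -
  show "norm T \<le> t' / r"
  proof (rule norm_blinfun_bound)
    fix x
    show "norm (blinfun_apply T x) \<le> t' / r * norm x"
    proof (cases "x = 0")
      case False
      have "(r / norm x) *\<^sub>R x \<in> P" using P(1) False \<open>r > 0\<close> by (auto simp: subset_iff)
      then have "norm (blinfun_apply T ((r / norm x) *\<^sub>R x)) \<le> t'" using TP(2) by auto
      then show ?thesis using False \<open>r > 0\<close> by (simp add: blinfun.scaleR_right field_simps)
    qed simp
  qed (use assms in auto)
  show "r' / t * norm x \<le> norm (blinfun_apply T x)"
  proof (cases "blinfun_apply T x = 0")
    case True
    then have "x = 0" using T by (metis bij_is_inj blinfun.zero_right injD)
    then show ?thesis by simp
  next
    case False
    \<comment> \<open>The factor that gives the image of \<open>k *\<^sub>R x\<close> norm exactly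
      \<open>r'\<close>, so that this image lies in the image of \<open>P\<close>; injectivity then
      brings \<open>k *\<^sub>R x\<close> itself into \<open>P\<close>.\<close>
    define k where "k = r' / norm (blinfun_apply T x)"
    have "k > 0" using False \<open>r' > 0\<close> by (simp add: k_def)
    have "blinfun_apply T (k *\<^sub>R x) \<in> cball 0 r'"
      using False \<open>r' > 0\<close> by (simp add: k_def blinfun.scaleR_right)
    then obtain p where "p \<in> P" "blinfun_apply T (k *\<^sub>R x) = blinfun_apply T p"
      using TP(1) by blast
    then have "k *\<^sub>R x \<in> P" using T by (metis bij_is_inj injD)
    then have "k * norm x \<le> t" using P(2) \<open>k > 0\<close> by auto
    then show ?thesis using False \<open>t > 0\<close> by (simp add: k_def field_simps)
  qed
qed

theorem theorem4p1:
  fixes D :: "'i::finite \<Rightarrow> 'k::finite set"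
    and idx :: "'m::finite \<Rightarrow> 'i \<Rightarrow> 'k"
  assumes "CARD('i) \<ge> 2"
    and "\<And>i. card (D i) \<ge> 2"
    and "bij_betw idx UNIV (Pi UNIV D)"
  shows "palais_proper (top_of_set (gl_tensor idx D)) (tensorial_topology idx D)
           (\<lambda>T Q. blinfun_apply T ` Q)"
proof -
  let ?X = "tensorial_topology idx D"
  let ?G = "top_of_set (gl_tensor idx D)"
  have top: "topspace ?X = tensorial_bodies idx D"
    unfolding tensorial_topology_def
    by (rule Metric_space.topspace_mtopology[OF Metric_space_hausdorff])
  have "\<exists>S. is_nbhd ?X Q S \<and> small_set ?G ?X (\<lambda>T Q. blinfun_apply T ` Q) S"
    if "Q \<in> tensorial_bodies idx D" for Q
  proof -
    obtain S r t where S: "is_nbhd ?X Q S" and rt: "r > 0" "t > 0"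
      and SP: "\<And>P. P \<in> S \<Longrightarrow> cball 0 r \<subseteq> P \<and> P \<subseteq> cball 0 t"
      using uniform_balls_near_body \<open>Q \<in> _\<close> by blast
    have "\<exists>V. is_nbhd ?X Q' V \<and> compactin ?G (?G closure_of
        {T \<in> topspace ?G. (\<lambda>Q. blinfun_apply T ` Q) ` S \<inter> V \<noteq> {}})"
      if "Q' \<in> tensorial_bodies idx D" for Q'
    proof -
      obtain V r' t' where V: "is_nbhd ?X Q' V" and rt': "r' > 0" "t' > 0"
        and VP: "\<And>P. P \<in> V \<Longrightarrow> cball 0 r' \<subseteq> P \<and> P \<subseteq> cball 0 t'"
        using uniform_balls_near_body \<open>Q' \<in> _\<close> by blast
      let ?A = "{T \<in> topspace ?G. (\<lambda>Q. blinfun_apply T ` Q) ` S \<inter> V \<noteq> {}}"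
      \<comment> \<open>The constants depend only on the two neighborhoods \<open>S\<close> and
        \<open>V\<close>, so one set \<open>K\<close> captures every \<open>T\<close> that maps some
        member of \<open>S\<close> into \<open>V\<close>.\<close>
      define K where "K = {T \<in> gl_tensor idx D.
        norm T \<le> t' / r \<and> (\<forall>x. r' / t * norm x \<le> norm (blinfun_apply T x))}"
      have "compact K"
        unfolding K_def by (rule compact_gl_tensor_bounded[OF assms(3)]) (use rt rt' in simp)
      moreover have "K \<subseteq> gl_tensor idx D" by (auto simp: K_def)
      ultimately have K: "compactin ?G K" by (simp add: compactin_subtopology)
      have "?A \<subseteq> K"
      proof
        fix T assume T: "T \<in> ?A"
        then obtain P where P: "P \<in> S" "blinfun_apply T ` P \<in> V" by auto
        have G: "T \<in> gl_tensor idx D" using T by simp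
        then have "bij (blinfun_apply T)" by (simp add: gl_tensor_def)
        note * = blinfun_bounds_of_image[OF this rt(1) rt'(1) rt(2) rt'(2), of P]
        show "T \<in> K" using * SP[OF P(1)] VP[OF P(2)] G by (simp add: K_def)
      qed
      \<comment> \<open>A compact set is closed in the Hausdorff topology of the group, so taking
        the closure of \<open>?A\<close> there does not leave \<open>K\<close>.\<close>
      moreover have "closedin ?G K"
        using K by (intro compactin_imp_closedin Hausdorff_space_subtopology) auto
      ultimately have "?G closure_of ?A \<subseteq> K" by (rule closure_of_minimal)
      then have "compactin ?G (?G closure_of ?A)"
        using closed_compactin K closedin_closure_of by blast
      with V show ?thesis by blast
    qed
    then have "small_set ?G ?X (\<lambda>T Q. blinfun_apply T ` Q) S"
      using S by (simp add: small_set_def top is_nbhd_def)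
    with S show ?thesis by blast
  qed
  then show ?thesis by (simp add: palais_proper_def top)
qed

end
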